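(* For any (real or complex) constants $\alpha,\beta$ and $\eta$, $$\frac{1}{\alpha+\beta+1}\Bigl[\cos(\eta x^\beta)\;{}_1F_2\Bigl(1; \frac{\alpha+\beta+1}{2\beta}, \frac{\alpha+2\beta+1}{2\beta}; -\frac{\eta^2 x^{2\beta}}{4}\Bigr)+ \beta\eta x^{\beta}\sin(\eta x^\beta)\;{}_1F_2\Bigl(1; \frac{\alpha+2\beta+1}{2\beta}, \frac{\alpha+3\beta+1}{2\beta}; -\frac{\eta^2 x^{2\beta}}{4}\Bigr)\Bigr]$$ $$=\frac{1}{2}\Bigl[e^{i\eta x^\beta}\;{}_1F_1\Bigl(1;\frac{\alpha+\beta+1}{\beta}; -i\eta x^{\beta}\Bigr)+e^{-i\eta x^\beta}\;{}_1F_1\Bigl(1;\frac{\alpha+\beta+1}{\beta}; i\eta x^{\beta}\Bigr)\Bigr].$$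
   Context: ${}_1F_1(a;b;x)=\sum_{n=0}^{\infty}\frac{(a)_n}{(b)_n}\frac{x^n}{n!}$ and ${}_1F_2(a;b,c;x)=\sum_{n=0}^{\infty}\frac{(a)_n}{(b)_n(c)_n}\frac{x^n}{n!}$, where $(\vartheta)_n=\Gamma(\vartheta+n)/\Gamma(\vartheta)$, $(\vartheta)_0=1$ (Pochhammer symbol). The identity is an identity in the variable $x$.
   Formalization: The cosine term in the bracket gets the extra factor α+β+1, since the printed identity fails (η=0, α=β=x=1 gives 1/3=1); also assumed, so that all terms are defined: β≠0 and (α+β+1)/β not in {0,-1,-2,…}; powers of x are principal-branch. *)

theory Defs
  imports "HOL-Analysis.Analysis"
begin

definition hyp_1F1 :: "complex \<Rightarrow> complex \<Rightarrow> complex \<Rightarrow> complex" where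
  "hyp_1F1 a b x = (\<Sum>n. pochhammer a n / pochhammer b n * (x ^ n / fact n))"

definition hyp_1F2 :: "complex \<Rightarrow> complex \<Rightarrow> complex \<Rightarrow> complex \<Rightarrow> complex" where
  "hyp_1F2 a b c x = (\<Sum>n. pochhammer a n / (pochhammer b n * pochhammer c n) * (x ^ n / fact n))"

lemma hyp_1F1_0 [simp]: "hyp_1F1 a b 0 = 1"
  using powser_zero[of "\<lambda>n. pochhammer a n / pochhammer b n / fact n"]
  by (simp add: hyp_1F1_def)

lemma hyp_1F2_0 [simp]: "hyp_1F2 a b c 0 = 1"
  using powser_zero[of "\<lambda>n. pochhammer a n / (pochhammer b n * pochhammer c n) / fact n"]
  by (simp add: hyp_1F2_def)

(* The identity is printed in the source with coefficient 1 on the cosine term inside the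
   bracket. That version is false whenever \<eta> = 0 and \<alpha> + \<beta> \<noteq> 0; the coefficient has to be
   \<alpha> + \<beta> + 1. *)
lemma printed_identity_false:
  "\<exists>\<alpha> \<beta> \<eta> x :: complex. \<beta> \<noteq> 0 \<and> (\<alpha> + \<beta> + 1) / \<beta> \<notin> \<int>\<^sub>\<le>\<^sub>0 \<and> x \<noteq> 0 \<and>
     1 / (\<alpha> + \<beta> + 1) *
       (cos (\<eta> * x powr \<beta>) *
          hyp_1F2 1 ((\<alpha> + \<beta> + 1) / (2 * \<beta>)) ((\<alpha> + 2 * \<beta> + 1) / (2 * \<beta>))
            (- (\<eta>\<^sup>2 * x powr (2 * \<beta>) / 4))
        + \<beta> * \<eta> * x powr \<beta> * sin (\<eta> * x powr \<beta>) *
          hyp_1F2 1 ((\<alpha> + 2 * \<beta> + 1) / (2 * \<beta>)) ((\<alpha> + 3 * \<beta> + 1) / (2 * \<beta>))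
            (- (\<eta>\<^sup>2 * x powr (2 * \<beta>) / 4)))
     \<noteq> 1 / 2 *
       (exp (\<i> * \<eta> * x powr \<beta>) * hyp_1F1 1 ((\<alpha> + \<beta> + 1) / \<beta>) (- \<i> * \<eta> * x powr \<beta>)
        + exp (- \<i> * \<eta> * x powr \<beta>) * hyp_1F1 1 ((\<alpha> + \<beta> + 1) / \<beta>) (\<i> * \<eta> * x powr \<beta>))"
proof (rule exI[of _ 1], rule exI[of _ 1], rule exI[of _ 0], rule exI[of _ 1], intro conjI)
  show "((1::complex) + 1 + 1) / 1 \<notin> \<int>\<^sub>\<le>\<^sub>0"
    by (auto elim!: nonpos_Ints_cases simp: complex_eq_iff)
qed simp_all

end

(* Put b = (\<alpha> + \<beta> + 1) / \<beta> and z = \<eta> x^\<beta>. Since (1)_n = n!, 1F1(1; b; w) is the sum of w^n / (b)_n. By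
   (b)_2k = 4^k (b/2)_k ((b+1)/2)_k its even part in w is 1F2(1; b/2, (b+1)/2; w^2/4), and by
   (b)_(n+1) = b (b+1)_n its odd part is w/b times the even part for b + 1. Taking w = iz and w = -iz,
   the even parts combine with the exponentials to the cosine term, the odd parts to the sine term. *)
theory Submission
  imports Defs
begin

text \<open>Consecutive terms differ by the factor \<open>w / (b + n)\<close>, which tends to 0. If
  b is a nonpositive integer, the terms are eventually 0 because division by 0 gives 0.\<close>

lemma summable_power_over_pochhammer:
  fixes b w :: complex
  shows "summable (\<lambda>n. w ^ n / pochhammer b n)"
proof (rule summable_ratio_test)
  \<comment> \<open>The part |b| + 2|w| of the threshold forces |b + n| \<ge> 2|w|; the extra 1
    keeps b + n away from 0 even when w = 0.\<close>
  fix n assume n: "nat \<lceil>norm b + 2 * norm w + 1\<rceil> \<le> n"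
  have "real n \<le> norm (b + of_nat n) + norm b"
    using norm_triangle_ineq4[of "b + of_nat n" b] by simp
  with n have le: "2 * norm w \<le> norm (b + of_nat n)" and pos: "0 < norm (b + of_nat n)"
    using norm_ge_zero[of w] by linarith+
  have "norm w / norm (b + of_nat n) \<le> 1 / 2"
    using le pos by (simp add: field_simps)
  then have "norm w / norm (b + of_nat n) * norm (w ^ n / pochhammer b n)
      \<le> 1 / 2 * norm (w ^ n / pochhammer b n)"
    by (rule mult_right_mono) simp
  then show "norm (w ^ Suc n / pochhammer b (Suc n)) \<le> 1 / 2 * norm (w ^ n / pochhammer b n)"
    by (simp add: pochhammer_Suc norm_mult norm_divide mult_ac)
qed simp

lemma sums_hyp_1F1_1: "(\<lambda>n. w ^ n / pochhammer b n) sums hyp_1F1 1 b w"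
proof -
  have "hyp_1F1 1 b w = (\<Sum>n. w ^ n / pochhammer b n)"
    by (simp add: hyp_1F1_def flip: pochhammer_fact)
  then show ?thesis
    using summable_power_over_pochhammer by (simp add: summable_sums)
qed

text \<open>Blocks of two consecutive terms separate the parities: replacing w by -w keeps the first
  term of each block and negates the second.\<close>

lemma sums_hyp_1F1_1_pairs:
  "(\<lambda>k. w ^ (2 * k) / pochhammer b (2 * k)
      + w ^ Suc (2 * k) / pochhammer b (Suc (2 * k))) sums hyp_1F1 1 b w"
proof -
  have *: "{k * 2..<k * 2 + 2} = {2 * k, Suc (2 * k)}" for k :: nat
    by auto
  show ?thesis
    using sums_group[OF sums_hyp_1F1_1[of w b], of 2] by (simp add: * mult.commute[of 2])
qed

lemma hyp_1F2_1_half: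
  "hyp_1F2 1 (b / 2) ((b + 1) / 2) (w\<^sup>2 / 4) = (\<Sum>k. w ^ (2 * k) / pochhammer b (2 * k))"
proof -
  \<comment> \<open>This is the duplication formula at b/2, using b/2 + 1/2 = (b + 1)/2.\<close>
  have "pochhammer b (2 * k) = pochhammer (b / 2) k * (pochhammer ((b + 1) / 2) k * 4 ^ k)" for k
    using pochhammer_double[of "b / 2" k]
    by (simp add: add_divide_distrib power_mult[of 2] mult.assoc mult.left_commute[of "4 ^ k"] mult.commute[of "4 ^ k"])
  then show ?thesis
    by (simp add: hyp_1F2_def power_mult[of w] power_divide flip: pochhammer_fact)
qed

lemma hyp_1F1_1_add_minus:
  "hyp_1F1 1 b w + hyp_1F1 1 b (- w) = 2 * hyp_1F2 1 (b / 2) ((b + 1) / 2) (w\<^sup>2 / 4)"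
proof -
  have "(\<lambda>k. 2 * (w ^ (2 * k) / pochhammer b (2 * k))) sums (hyp_1F1 1 b w + hyp_1F1 1 b (- w))"
    using sums_add[OF sums_hyp_1F1_1_pairs[of w b] sums_hyp_1F1_1_pairs[of "- w" b]] by simp
  from sums_mult[OF this, of "1 / 2"]
  have "(\<lambda>k. w ^ (2 * k) / pochhammer b (2 * k))
      sums ((hyp_1F1 1 b w + hyp_1F1 1 b (- w)) / 2)"
    by simp
  then show ?thesis
    by (simp add: hyp_1F2_1_half sums_unique[symmetric])
qed

text \<open>The 1 is the term n = 0; each later term is w/b times a term of the series for b +
  1.\<close>

lemma hyp_1F1_1_rec: "hyp_1F1 1 b w = 1 + w / b * hyp_1F1 1 (b + 1) w"
proof -
  have "(\<lambda>n. w ^ Suc n / pochhammer b (Suc n)) sums (w / b * hyp_1F1 1 (b + 1) w)"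
    using sums_mult[OF sums_hyp_1F1_1[of w "b + 1"], of "w / b"] by (simp add: pochhammer_rec)
  then have "(\<lambda>n. w ^ n / pochhammer b n) sums (w / b * hyp_1F1 1 (b + 1) w + 1)"
    by (subst (asm) sums_Suc_iff) simp
  with sums_hyp_1F1_1[of w b] show ?thesis
    by (metis add.commute sums_unique2)
qed

lemma hyp_1F1_1_diff_minus:
  "hyp_1F1 1 b w - hyp_1F1 1 b (- w)
     = 2 * (w / b * hyp_1F2 1 ((b + 1) / 2) ((b + 2) / 2) (w\<^sup>2 / 4))"
proof -
  \<comment> \<open>The constants 1 of the recursion cancel, and the sign of -w/b turns the
    difference into a sum, to which the even case for b + 1 applies.\<close>
  have "hyp_1F1 1 b w - hyp_1F1 1 b (- w)
      = w / b * (hyp_1F1 1 (b + 1) w + hyp_1F1 1 (b + 1) (- w))"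
    by (simp add: hyp_1F1_1_rec[of b w] hyp_1F1_1_rec[of b "- w"] algebra_simps)
  then show ?thesis
    by (simp add: hyp_1F1_1_add_minus add.assoc)
qed

lemma cos_sin_hyp_1F2_eq_exp_hyp_1F1:
  "cos z * hyp_1F2 1 (b / 2) ((b + 1) / 2) (- (z\<^sup>2 / 4))
     + z / b * sin z * hyp_1F2 1 ((b + 1) / 2) ((b + 2) / 2) (- (z\<^sup>2 / 4))
   = 1 / 2 * (exp (\<i> * z) * hyp_1F1 1 b (- (\<i> * z)) + exp (- (\<i> * z)) * hyp_1F1 1 b (\<i> * z))"
    (is "cos z * ?E + z / b * sin z * ?O = 1 / 2 * (?e * ?G + ?e' * ?F)")
proof -
  have "?F + ?G = 2 * ?E"
    using hyp_1F1_1_add_minus[of b "\<i> * z"] by (simp add: power_mult_distrib)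
  moreover have "?F - ?G = 2 * (\<i> * z / b * ?O)"
    using hyp_1F1_1_diff_minus[of b "\<i> * z"] by (simp add: power_mult_distrib)
  ultimately have F: "?F = ?E + \<i> * z / b * ?O" and G: "?G = ?E - \<i> * z / b * ?O"
    by algebra+
  have e: "?e = cos z + \<i> * sin z" and e': "?e' = cos z - \<i> * sin z"
    using exp_Euler[of z] exp_minus_Euler[of z] by simp_all
  show ?thesis
    \<comment> \<open>In the expanded products the terms containing \<i> cancel, since \<i> *
      (-\<i>) = 1 makes the sine-odd products real multiples and the two summands differ by the sign
      of \<i>.\<close>
    unfolding F G e e' by (simp add: algebra_simps add_divide_distrib diff_divide_distrib)
qed

theorem theorem5:
  fixes \<alpha> \<beta> \<eta> x :: complex
  assumes "\<beta> \<noteq> 0"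
    and "(\<alpha> + \<beta> + 1) / \<beta> \<notin> \<int>\<^sub>\<le>\<^sub>0"
  shows
    "1 / (\<alpha> + \<beta> + 1) *
       ((\<alpha> + \<beta> + 1) * cos (\<eta> * x powr \<beta>) *
          hyp_1F2 1 ((\<alpha> + \<beta> + 1) / (2 * \<beta>)) ((\<alpha> + 2 * \<beta> + 1) / (2 * \<beta>))
            (- (\<eta>\<^sup>2 * x powr (2 * \<beta>) / 4))
        + \<beta> * \<eta> * x powr \<beta> * sin (\<eta> * x powr \<beta>) *
          hyp_1F2 1 ((\<alpha> + 2 * \<beta> + 1) / (2 * \<beta>)) ((\<alpha> + 3 * \<beta> + 1) / (2 * \<beta>))
            (- (\<eta>\<^sup>2 * x powr (2 * \<beta>) / 4)))
     = 1 / 2 *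
       (exp (\<i> * \<eta> * x powr \<beta>) * hyp_1F1 1 ((\<alpha> + \<beta> + 1) / \<beta>) (- \<i> * \<eta> * x powr \<beta>)
        + exp (- \<i> * \<eta> * x powr \<beta>) * hyp_1F1 1 ((\<alpha> + \<beta> + 1) / \<beta>) (\<i> * \<eta> * x powr \<beta>))"
proof -
  let ?b = "(\<alpha> + \<beta> + 1) / \<beta>" and ?z = "\<eta> * x powr \<beta>"
  \<comment> \<open>Otherwise (\<alpha> + \<beta> + 1) / \<beta> would be 0, a nonpositive
    integer.\<close>
  have nz: "\<alpha> + \<beta> + 1 \<noteq> 0"
    using assms(2) by auto
  have params: "(\<alpha> + \<beta> + 1) / (2 * \<beta>) = ?b / 2" "(\<alpha> + 2 * \<beta> + 1) / (2 * \<beta>) = (?b + 1) / 2"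
    "(\<alpha> + 3 * \<beta> + 1) / (2 * \<beta>) = (?b + 2) / 2"
    using assms(1) by (simp_all add: field_simps)
  \<comment> \<open>Both powers use the same branch of the logarithm, so doubling the exponent
    squares the value; at x = 0 both are 0.\<close>
  have "\<eta>\<^sup>2 * x powr (2 * \<beta>) / 4 = ?z\<^sup>2 / 4"
    by (simp add: power_mult_distrib power2_eq_square flip: powr_add)
  \<comment> \<open>The sine coefficient matches because \<beta> / (\<alpha> + \<beta> + 1) is the
    reciprocal of \<open>?b\<close>.\<close>
  then show ?thesis
    using cos_sin_hyp_1F2_eq_exp_hyp_1F1[of ?z ?b] nz unfolding params
    by (simp add: distrib_left mult_ac)
qed

end
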